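(* Let $D$ be a Dyck path of length $n$ and let $\mathcal G$ be its associated collection of intervals. Then $P_{\mathcal G}$ is a simple polytope.
   Context: A Dyck path $D$ of length $n$ is a lattice path from $(1,0)$ to $(n+1,n)$ with up steps $(i,j)\to(i,j+1)$ and down steps $(i,j)\to(i+1,j)$, all of whose vertices satisfy $j\ge i-1$. Lattice points are relabelled by intervals: the point $(a,b)$, $1\le a\le n+1$, $a-1\le b\le n$, is labelled by the interval $[a-1,b]\subset\{0,\dots,n\}$; so intervals $[i,j]$, $0\le i\le j\le n$, label the lattice points on and above the baseline. The collection associated to $D$ is $\mathcal G=\{G\subseteq\{0,\dots,n\}\text{ an interval}: G\text{ lies on or below }D\text{ and }|G|>1\}$. (Equivalently, $\mathcal G$ is a collection of intervals $[i,j]$, $0\le i<j\le n$, containing all $[i-1,i]$ for $1\le i\le n$, and such that if $[i,j]\notin\mathcal G$, $i<j$, then no interval containing $[i,j]$ is in $\mathcal G$.) For $G\subseteq\{0,\dots,n\}$, $\Delta_G=\{(x_0,\dots,x_n)\in\mathbb{R}^{n+1}: x_i\ge0,\ x_i=0\text{ if }i\notin G,\ x_0+\cdots+x_n=1\}$, and $P_{\mathcal G}=\sum_{G\in\mathcal G}\Delta_G$ (Minkowski sum), an $n$-dimensional polytope. (For $\mathcal A=\mathbb{C}A_n/I_D$, $P_{\mathcal G}$ is isomorphic to $P_{\mathcal A}=\sum\mathrm{Newt}(1+y_i+y_iy_{i+1}+\cdots+y_i\cdots y_j)$, the sum being over the points $(i,j)$, $1\le i\le j\le n$, on or below $D$.)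 A polytope of dimension $n$ is simple if each vertex lies in exactly $n$ facets. *)

theory Defs
  imports "HOL-Analysis.Analysis"
begin

definition lattice_step :: "nat \<times> nat \<Rightarrow> nat \<times> nat \<Rightarrow> bool" where
  "lattice_step p q \<longleftrightarrow> (\<exists>i j. p = (i, j) \<and> (q = (i, j + 1) \<or> q = (i + 1, j)))"

text \<open>A path is given by the list of its vertices. The condition \<open>j \<ge> i - 1\<close> is written
  \<open>i \<le> j + 1\<close> to avoid truncated subtraction.\<close>

definition dyck_path :: "nat \<Rightarrow> (nat \<times> nat) list \<Rightarrow> bool" where
  "dyck_path n D \<longleftrightarrow>
     D \<noteq> [] \<and> hd D = (1, 0) \<and> last D = (n + 1, n) \<and>
     successively lattice_step D \<and> (\<forall>(i, j) \<in> set D. i \<le> j + 1)"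

text \<open>The first coordinate runs horizontally, so a lattice point is compared with the
  vertices of the path on the same vertical line.\<close>

definition on_or_below :: "nat \<times> nat \<Rightarrow> (nat \<times> nat) list \<Rightarrow> bool" where
  "on_or_below p D \<longleftrightarrow> (\<exists>h. (fst p, h) \<in> set D \<and> snd p \<le> h)"

definition interval_label :: "nat \<times> nat \<Rightarrow> nat set" where
  "interval_label p = {fst p - 1..snd p}"

definition dyck_collection :: "nat \<Rightarrow> (nat \<times> nat) list \<Rightarrow> nat set set" where
  "dyck_collection n D =
     {interval_label (a, b) | a b. 1 \<le> a \<and> a \<le> n + 1 \<and> a - 1 \<le> b \<and> b \<le> n \<and>
        on_or_below (a, b) D \<and> card (interval_label (a, b)) > 1}"

text \<open>The space of vectors \<open>(x\<^sub>0, \<dots>, x\<^sub>n)\<close> is \<^typ>\<open>real ^ 'n\<close>, where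
  \<open>lab\<close> is meant to be a bijection from the index type onto \<open>{0..n}\<close>; the component
  \<open>x\<^sub>k\<close> is \<open>x $ i\<close> for the \<open>i\<close> with \<open>lab i = k\<close>.\<close>

definition face_simplex :: "('n::finite \<Rightarrow> nat) \<Rightarrow> nat set \<Rightarrow> (real ^ 'n) set" where
  "face_simplex lab G =
     {x. (\<forall>i. x $ i \<ge> 0) \<and> (\<forall>i. lab i \<notin> G \<longrightarrow> x $ i = 0) \<and> (\<Sum>i\<in>UNIV. x $ i) = 1}"

text \<open>The sum is the Minkowski sum of sets, one summand for each \<open>G\<close>.\<close>

definition collection_polytope ::
    "('n::finite \<Rightarrow> nat) \<Rightarrow> nat set set \<Rightarrow> (real ^ 'n) set" where
  "collection_polytope lab \<G> = (\<Sum>G\<in>\<G>. face_simplex lab G)"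

definition simple_polytope :: "'a::euclidean_space set \<Rightarrow> bool" where
  "simple_polytope P \<longleftrightarrow>
     polytope P \<and>
     (\<forall>v. v extreme_point_of P \<longrightarrow> int (card {F. F facet_of P \<and> v \<in> F}) = aff_dim P)"

end

theory Submission
  imports Defs
begin

text \<open>
  Why the polytope is simple. Let \<open>v\<close> be a vertex of \<open>P = \<Sum>\<^sub>G \<Delta>\<^sub>G\<close> and let \<open>w\<close> be a linear
  functional that attains its minimum over \<open>P\<close> exactly at \<open>v\<close>. A Minkowski sum is minimised
  summand by summand, so each interval \<open>G\<close> contains a unique index \<open>c(G)\<close> of least weight, and
  \<open>v = \<Sum>\<^sub>G e\<^bsub>c(G)\<^esub>\<close>. Exchanging \<open>e\<^bsub>c(G)\<^esub>\<close> for another \<open>e\<^sub>b\<close> with \<open>b \<in> G\<close> shows that the cone of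
  \<open>P\<close> at \<open>v\<close> is generated by the differences \<open>e\<^sub>b - e\<^bsub>c(G)\<^esub>\<close>. Because the collection is closed
  under subintervals, \<open>G\<close> may be replaced here by the interval spanned by \<open>c(G)\<close> and \<open>b\<close>; this
  gives a relation \<open>precedes\<close> between indices, with \<open>w\<close> strictly increasing along it. The
  related pairs that no third index splits into two related pairs, \<open>covers\<close>, already generate
  the cone; they are regarded as the edges of a graph on the indices.

  The heart of the matter is that this graph has at most \<open>n\<close> edges: sending the edge
  from \<open>a\<close> to \<open>b\<close> to the unit gap next to \<open>a\<close> in the direction of \<open>b\<close> is injective
  (\<open>inj_on_first_gap\<close>). As consecutive indices are always related, the graph connects all
  \<open>n + 1\<close> indices, so it is a tree and the edge vectors are linearly independent
  (\<open>independent_edge_vectors\<close>). A polytope whose cone at a vertex is generated by linearly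
  independent vectors has as many facets through that vertex as there are generators, and this
  number is its dimension (\<open>facets_at_simplicial_vertex\<close>).
\<close>

section \<open>Vertices with a simplicial cone\<close>

lemma convex_cone_hull_sum:
  assumes "\<And>i. i \<in> A \<Longrightarrow> f i \<in> convex_cone hull S"
  shows "sum f A \<in> convex_cone hull S"
  using assms
  by (induction A rule: infinite_finite_induct)
     (auto intro: convex_cone_hull_add convex_cone_hull_contains_0)

lemma convex_cone_hull_subset_span: "convex_cone hull S \<subseteq> span S"
  by (intro hull_minimal span_superset subspace_imp_convex_cone subspace_span)

lemma aff_dim_eq_card:
  fixes F :: "'a::euclidean_space set"
  assumes "v \<in> F" "independent Z" "\<And>u. u \<in> Z \<Longrightarrow> v + u \<in> F"
    and "\<And>x. x \<in> F \<Longrightarrow> x - v \<in> span Z"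
  shows "aff_dim F = int (card Z)"
proof -
  have "aff_dim F = int (dim ((\<lambda>x. x - v) ` F))"
    using assms(1) by (intro aff_dim_eq_dim_subtract hull_inc)
  moreover have "dim ((\<lambda>x. x - v) ` F) = card Z"
  proof (rule dim_unique[of Z])
    show "Z \<subseteq> (\<lambda>x. x - v) ` F"
      using assms(3) by (force intro: image_eqI[of _ _ "v + _"])
  qed (use assms in auto)
  ultimately show ?thesis by simp
qed

lemma dual_vector:
  fixes U :: "'a::euclidean_space set"
  assumes "independent U"
  obtains d where "\<And>u u'. u' \<in> U \<Longrightarrow> d u \<bullet> u' = (if u' = u then 1 else 0)"
proof -
  have "\<exists>z. \<forall>u'\<in>U. z \<bullet> u' = (if u' = u then 1 else (0::real))" for u
  proof -
    obtain g :: "'a \<Rightarrow> real" where g: "linear g" "\<forall>x\<in>U. g x = (if x = u then 1 else 0)"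
      using linear_independent_extend[OF assms, of "\<lambda>x. if x = u then 1 else 0"] by blast
    have "adjoint g 1 \<bullet> x = g x" for x
      using adjoint_works[OF g(1), of x 1] by (simp add: inner_commute)
    then show ?thesis using g(2) by (intro exI[of _ "adjoint g 1"]) simp
  qed
  then show ?thesis using that by metis
qed

text \<open>The dual vectors of the generators serve as coordinates \<open>d u \<bullet> (x - v)\<close> on the polytope.
  All coordinates are nonnegative, so a face through \<open>v\<close> is cut out by the vanishing of those
  coordinates whose generator is not an edge direction of the face; facets are the faces where
  exactly one coordinate vanishes.\<close>

lemma facets_at_simplicial_vertex:
  fixes P :: "'a::euclidean_space set"
  assumes P: "polytope P" and v: "v \<in> P" and U: "independent U"
    and edge: "\<And>u. u \<in> U \<Longrightarrow> v + u \<in> P"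
    and cone: "\<And>x. x \<in> P \<Longrightarrow> x - v \<in> convex_cone hull U"
  shows "card {F. F facet_of P \<and> v \<in> F} = card U" and "aff_dim P = int (card U)"
proof -
  have fin: "finite U" using U by (simp add: independent_imp_finite)
  obtain d where d: "\<And>u u'. u' \<in> U \<Longrightarrow> d u \<bullet> u' = (if u' = u then 1 else 0)"
    using dual_vector[OF U] by metis
  have nonneg: "d u \<bullet> (x - v) \<ge> 0" if "u \<in> U" "x \<in> P" for u x
  proof -
    have "convex_cone hull U \<subseteq> {y. d u \<bullet> y \<ge> 0}"
      using that(1) by (intro hull_minimal convex_cone_halfspace_ge) (auto simp: d)
    then show ?thesis using cone[OF that(2)] by blast
  qed
  have expand: "x - v = (\<Sum>u\<in>U. (d u \<bullet> (x - v)) *\<^sub>R u)" if "x \<in> P" for x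
  proof (rule linear_eq_on[of "\<lambda>y. y" "\<lambda>y. \<Sum>u\<in>U. (d u \<bullet> y) *\<^sub>R u" _ U])
    show "linear (\<lambda>y. \<Sum>u\<in>U. (d u \<bullet> y) *\<^sub>R u)"
      by (rule linearI) (simp_all add: inner_add_right scaleR_add_left sum.distrib scaleR_sum_right)
    show "u' = (\<Sum>u\<in>U. (d u \<bullet> u') *\<^sub>R u)" if "u' \<in> U" for u'
      using fin that by (simp add: d if_distrib[of "\<lambda>c. c *\<^sub>R _"] cong: if_cong)
    show "x - v \<in> span U"
      using cone[OF that] convex_cone_hull_subset_span by blast
  qed (rule linear_ident)
  show dimP: "aff_dim P = int (card U)"
    using convex_cone_hull_subset_span cone by (intro aff_dim_eq_card[of v]) (use v U edge in auto)
  have face_eq: "F = {x \<in> P. \<forall>u\<in>U. v + u \<notin> F \<longrightarrow> d u \<bullet> (x - v) = 0}"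
    if F: "F face_of P" "v \<in> F" for F
  proof -
    obtain a b where le: "P \<subseteq> {x. a \<bullet> x \<le> b}" and Feq: "F = P \<inter> {x. a \<bullet> x = b}"
      using F(1) exposed_face_of_polyhedron[OF polytope_imp_polyhedron[OF P]]
      unfolding exposed_face_of_def by blast
    have b: "b = a \<bullet> v" using F(2) Feq by auto
    have au: "a \<bullet> u \<le> 0" "v + u \<in> F \<longleftrightarrow> a \<bullet> u = 0" if "u \<in> U" for u
      using edge[OF that] le b Feq by (auto simp: inner_add_right)
    \<comment> \<open>Each term of \<open>a \<bullet> (x - v)\<close>, expanded in coordinates, is at most zero, so the sum
      vanishes only if every term does.\<close>
    have "x \<in> F \<longleftrightarrow> (\<forall>u\<in>U. v + u \<notin> F \<longrightarrow> d u \<bullet> (x - v) = 0)" if x: "x \<in> P" for x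
    proof -
      have "a \<bullet> (x - v) = (\<Sum>u\<in>U. (d u \<bullet> (x - v)) * (a \<bullet> u))"
        using arg_cong[OF expand[OF x], of "inner a"] by (simp add: inner_sum_right)
      then have "x \<in> F \<longleftrightarrow> (\<Sum>u\<in>U. - ((d u \<bullet> (x - v)) * (a \<bullet> u))) = 0"
        using x Feq b by (auto simp: inner_diff_right sum_negf)
      also have "\<dots> \<longleftrightarrow> (\<forall>u\<in>U. - ((d u \<bullet> (x - v)) * (a \<bullet> u)) = 0)"
        using nonneg[OF _ x] au(1) fin
        by (intro sum_nonneg_eq_0_iff) (auto intro: mult_nonneg_nonpos)
      also have "\<dots> \<longleftrightarrow> (\<forall>u\<in>U. v + u \<notin> F \<longrightarrow> d u \<bullet> (x - v) = 0)"
        using au(2) by auto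
      finally show ?thesis .
    qed
    moreover have "F \<subseteq> P" using Feq by blast
    ultimately show ?thesis by blast
  qed
  have face_dim: "aff_dim F = int (card {u \<in> U. v + u \<in> F})"
    if F: "F face_of P" "v \<in> F" for F
  proof (rule aff_dim_eq_card[of v])
    show "independent {u \<in> U. v + u \<in> F}"
      using U by (rule independent_mono) auto
    fix x assume x: "x \<in> F"
    then have xP: "x \<in> P" using F(1) face_of_imp_subset by blast
    have "x - v = (\<Sum>u\<in>{u \<in> U. v + u \<in> F}. (d u \<bullet> (x - v)) *\<^sub>R u)"
      using face_eq[OF F] x fin
      by (subst expand[OF xP], intro sum.mono_neutral_right) auto
    then show "x - v \<in> span {u \<in> U. v + u \<in> F}"
      by (metis (no_types, lifting) span_base span_scale span_sum)
  qed (use F in auto)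
  define H where "H u = P \<inter> {x. d u \<bullet> x = d u \<bullet> v}" for u
  have H_edge: "v + u' \<in> H u \<longleftrightarrow> u' \<noteq> u" if "u \<in> U" "u' \<in> U" for u u'
    using that d edge by (auto simp: H_def inner_add_right)
  have vH: "v \<in> H u" for u using v by (simp add: H_def)
  have H_face: "H u face_of P" if "u \<in> U" for u
    unfolding H_def
  proof (rule face_of_Int_supporting_hyperplane_ge)
    show "convex P" using P by (rule polytope_imp_convex)
    show "d u \<bullet> v \<le> d u \<bullet> x" if "x \<in> P" for x
      using nonneg[OF \<open>u \<in> U\<close> that] by (simp add: inner_diff_right)
  qed
  have "{F. F facet_of P \<and> v \<in> F} = H ` U"
  proof (intro equalityI subsetI)
    fix F assume "F \<in> H ` U"
    then obtain u where u: "u \<in> U" "F = H u" by auto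
    have "{u' \<in> U. v + u' \<in> H u} = U - {u}" using H_edge[OF u(1)] by auto
    then have "aff_dim (H u) = int (card U) - 1"
      using face_dim[OF H_face[OF u(1)] vH] card_Suc_Diff1[OF fin u(1)] by simp
    then show "F \<in> {F. F facet_of P \<and> v \<in> F}"
      using u H_face vH dimP by (auto simp: facet_of_def)
  next
    fix F assume "F \<in> {F. F facet_of P \<and> v \<in> F}"
    then have F: "F face_of P" "v \<in> F" "aff_dim F = int (card U) - 1"
      using dimP by (auto simp: facet_of_def)
    have "card U = card {u \<in> U. v + u \<in> F} + 1"
      using face_dim[OF F(1,2)] F(3) by simp
    moreover have "card U = card {u \<in> U. v + u \<in> F} + card {u \<in> U. v + u \<notin> F}"
      using fin by (subst card_Un_disjoint[symmetric]) (auto intro: arg_cong[of _ _ card])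
    ultimately have "card {u \<in> U. v + u \<notin> F} = 1" by simp
    then obtain u where "{u \<in> U. v + u \<notin> F} = {u}" by (auto simp: card_1_singleton_iff)
    then have u: "u \<in> U" and "\<forall>u'\<in>U. v + u' \<notin> F \<longleftrightarrow> u' = u" by auto
    then have "F = H u"
      by (subst face_eq[OF F(1,2)]) (auto simp: H_def inner_diff_right)
    then show "F \<in> H ` U" using u by blast
  qed
  moreover have "inj_on H U"
    using H_edge by (metis inj_onI)
  ultimately show "card {F. F facet_of P \<and> v \<in> F} = card U"
    by (simp add: card_image)
qed

section \<open>Sums of simplices\<close>

lemma axis_in_face_simplex: "axis i 1 \<in> face_simplex lab G \<longleftrightarrow> lab i \<in> G"
  by (auto simp: face_simplex_def axis_def)

lemma face_simplex_eq_hull: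
  "face_simplex lab G = convex hull {axis i 1 | i. lab i \<in> G}"
proof
  show "convex hull {axis i 1 | i. lab i \<in> G} \<subseteq> face_simplex lab G"
  proof (rule hull_minimal)
    show "convex (face_simplex lab G)"
      unfolding face_simplex_def convex_def
      by (auto simp: sum.distrib simp flip: sum_distrib_left)
  qed (auto simp: axis_in_face_simplex)
  show "face_simplex lab G \<subseteq> convex hull {axis i 1 | i. lab i \<in> G}"
  proof
    fix x assume x: "x \<in> face_simplex lab G"
    have supp: "(\<Sum>i\<in>{i. lab i \<in> G}. f i) = (\<Sum>i\<in>UNIV. f i)"
      if "\<And>i. x $ i = 0 \<Longrightarrow> f i = 0" for f :: "_ \<Rightarrow> 'b::comm_monoid_add"
      using x that by (intro sum.mono_neutral_left) (auto simp: face_simplex_def)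
    have "(\<Sum>i\<in>{i. lab i \<in> G}. (x $ i) *\<^sub>R axis i 1) \<in> convex hull {axis i 1 | i. lab i \<in> G}"
      using x by (intro convex_sum) (auto simp: face_simplex_def supp intro: hull_inc)
    also have "(\<Sum>i\<in>{i. lab i \<in> G}. (x $ i) *\<^sub>R axis i 1) = x"
      by (subst supp) (auto simp: vec_eq_iff axis_def if_distrib cong: if_cong)
    finally show "x \<in> convex hull {axis i 1 | i. lab i \<in> G}" .
  qed
qed

lemma polytope_collection_polytope:
  assumes "finite \<G>"
  shows "polytope (collection_polytope lab \<G>)"
proof -
  have "finite (\<Sum>G\<in>\<G>. {axis i (1::real) | i. lab i \<in> G})"
    using assms by induction (auto simp: intro!: finite_set_plus)
  then show ?thesis
    unfolding collection_polytope_def face_simplex_eq_hull polytope_def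
    by (auto simp flip: convex_hull_set_sum)
qed

section \<open>The tree of edge directions at a vertex\<close>

locale interval_collection =
  fixes n :: nat and lab :: "'n::finite \<Rightarrow> nat" and \<G> :: "nat set set"
  assumes lab: "bij_betw lab UNIV {0..n}"
    and interval: "G \<in> \<G> \<Longrightarrow> \<exists>i j. i < j \<and> j \<le> n \<and> G = {i..j}"
    and subinterval: "{i..j} \<in> \<G> \<Longrightarrow> i \<le> i' \<Longrightarrow> i' < j' \<Longrightarrow> j' \<le> j \<Longrightarrow> {i'..j'} \<in> \<G>"
    and consecutive: "k < n \<Longrightarrow> {k..Suc k} \<in> \<G>"
begin

lemma lab_eq_iff [simp]: "lab a = lab b \<longleftrightarrow> a = b"
  using lab by (meson bij_betw_imp_inj_on inj_eq)

lemma lab_le: "lab a \<le> n"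
  using bij_betwE[OF lab] by simp

lemma lab_surj: "k \<le> n \<Longrightarrow> \<exists>a. lab a = k"
  using bij_betw_imp_surj_on[OF lab] by (metis atLeastAtMost_iff imageE le0)

lemma finite_collection: "finite \<G>"
proof (rule finite_subset[of _ "Pow {0..n}"])
  show "\<G> \<subseteq> Pow {0..n}"
  proof
    fix G assume "G \<in> \<G>"
    then obtain i j where "j \<le> n" "G = {i..j}" using interval by blast
    then show "G \<in> Pow {0..n}" by auto
  qed
qed simp

definition interval_between :: "'n \<Rightarrow> 'n \<Rightarrow> nat set" where
  "interval_between a b = {min (lab a) (lab b)..max (lab a) (lab b)}"

lemma interval_between_self [simp]: "lab a \<in> interval_between a b" "lab b \<in> interval_between a b"
  by (auto simp: interval_between_def)

lemma interval_between_subset: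
  assumes "G \<in> \<G>" "lab a \<in> G" "lab b \<in> G"
  shows "interval_between a b \<subseteq> G"
proof -
  obtain i j where "G = {i..j}" using interval[OF assms(1)] by blast
  then show ?thesis using assms(2,3) by (simp add: interval_between_def)
qed

lemma interval_between_mem:
  assumes "G \<in> \<G>" "lab a \<in> G" "lab b \<in> G" "a \<noteq> b"
  shows "interval_between a b \<in> \<G>"
proof -
  obtain i j where "G = {i..j}" using interval[OF assms(1)] by blast
  moreover have "lab a < lab b \<or> lab b < lab a" using assms(4) by (simp flip: neq_iff)
  ultimately show ?thesis
    unfolding interval_between_def using assms(1-3) by (auto intro: subinterval[of i j])
qed

end

text \<open>The weights play the role of the coefficients of a linear functional whose minimum over the
  polytope is attained at one point only.\<close>

locale generic_weight = interval_collection n lab \<G>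
  for n and lab :: "'n::finite \<Rightarrow> nat" and \<G> +
  fixes w :: "'n \<Rightarrow> real"
  assumes unique_min: "G \<in> \<G> \<Longrightarrow> \<exists>c. lab c \<in> G \<and> (\<forall>k. lab k \<in> G \<longrightarrow> k \<noteq> c \<longrightarrow> w c < w k)"
begin

definition least :: "nat set \<Rightarrow> 'n" where
  "least G = (SOME c. lab c \<in> G \<and> (\<forall>k. lab k \<in> G \<longrightarrow> k \<noteq> c \<longrightarrow> w c < w k))"

lemma
  assumes "G \<in> \<G>"
  shows least_mem: "lab (least G) \<in> G"
    and least_less: "lab k \<in> G \<Longrightarrow> k \<noteq> least G \<Longrightarrow> w (least G) < w k"
proof -
  have "lab (least G) \<in> G \<and> (\<forall>k. lab k \<in> G \<longrightarrow> k \<noteq> least G \<longrightarrow> w (least G) < w k)"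
    unfolding least_def by (rule someI_ex[OF unique_min[OF assms]])
  then show "lab (least G) \<in> G" and "lab k \<in> G \<Longrightarrow> k \<noteq> least G \<Longrightarrow> w (least G) < w k"
    by blast+
qed

definition precedes :: "'n \<Rightarrow> 'n \<Rightarrow> bool" where
  "precedes a b \<longleftrightarrow> a \<noteq> b \<and> interval_between a b \<in> \<G> \<and> least (interval_between a b) = a"

definition covers :: "'n \<Rightarrow> 'n \<Rightarrow> bool" where
  "covers a b \<longleftrightarrow> precedes a b \<and> \<not> (\<exists>c. precedes a c \<and> precedes c b)"

lemma precedes_less: "precedes a b \<Longrightarrow> lab k \<in> interval_between a b \<Longrightarrow> k \<noteq> a \<Longrightarrow> w a < w k"
  using least_less[of "interval_between a b" k] by (simp add: precedes_def)

text \<open>Passing from \<open>G\<close> to a subinterval does not change the least element as long as the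
  subinterval contains it. Hence the direction \<open>e\<^sub>k - e\<^sub>c\<close> contributed by \<open>G\<close> is also
  contributed by the interval spanned by \<open>c\<close> and \<open>k\<close>.\<close>

lemma least_precedes:
  assumes "G \<in> \<G>" "lab k \<in> G" "k \<noteq> least G"
  shows "precedes (least G) k"
proof -
  have mem: "interval_between (least G) k \<in> \<G>"
    using assms least_mem by (intro interval_between_mem[of G]) auto
  have "least (interval_between (least G) k) = least G"
    using assms least_mem[OF mem] least_less[OF mem, of "least G"] least_less[OF assms(1)]
      interval_between_subset[OF assms(1) least_mem[OF assms(1)] assms(2)]
    by (metis interval_between_self(1) less_asym subsetD)
  then show ?thesis using mem assms(3) by (simp add: precedes_def)
qed

lemma precedes_inner:
  assumes "precedes a b" "lab k \<in> interval_between a b" "k \<noteq> a"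
  shows "precedes a k"
proof -
  have "interval_between a b \<in> \<G>" "least (interval_between a b) = a"
    using assms(1) by (auto simp: precedes_def)
  then show ?thesis using least_precedes assms(2,3) by metis
qed

text \<open>If both \<open>b\<close> and \<open>b'\<close> lay above \<open>a\<close> on the same side, with \<open>b\<close> nearer to \<open>a\<close>, then the least
  element of the interval between \<open>b\<close> and \<open>b'\<close> would interrupt one of the two covers.\<close>

lemma covers_same_side:
  assumes "covers a b" "covers a b'" "lab b \<in> interval_between a b'" "b \<noteq> b'"
  shows False
proof -
  have b: "precedes a b" and b': "precedes a b'" using assms by (auto simp: covers_def)
  have ab: "interval_between a b' \<in> \<G>" "a \<noteq> b" using b b' by (auto simp: precedes_def)
  have mem: "interval_between b b' \<in> \<G>"
    using interval_between_mem[OF ab(1) assms(3) interval_between_self(2) assms(4)] .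
  define m where "m = least (interval_between b b')"
  have m: "lab m \<in> interval_between b b'" using least_mem[OF mem] by (simp add: m_def)
  have "lab a \<noteq> lab b" using ab(2) by simp
  then have "lab a \<notin> interval_between b b'"
    using assms(3) unfolding interval_between_def atLeastAtMost_iff by linarith
  then have "a \<noteq> m" using m by blast
  moreover have "lab m \<in> interval_between a b'"
    using m interval_between_subset[OF ab(1) assms(3) interval_between_self(2)] by auto
  ultimately have am: "precedes a m" using precedes_inner[OF b'] by metis
  show False
  proof (cases "m = b'")
    case True
    then have "precedes b' b" using least_precedes[OF mem, of b] assms(4) by (auto simp: m_def)
    then show False using b' assms(1) by (auto simp: covers_def)
  next
    case False
    then have "precedes m b'" using least_precedes[OF mem, of b'] by (auto simp: m_def)
    then show False using am assms(2) by (auto simp: covers_def)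
  qed
qed

text \<open>The gap between \<open>k\<close> and \<open>k + 1\<close> is named by \<open>k\<close>.\<close>

definition first_gap :: "'n \<times> 'n \<Rightarrow> nat" where
  "first_gap = (\<lambda>(a, b). if lab a < lab b then lab a else lab a - 1)"

text \<open>Edges with the same first gap either leave the same index to the same side, or leave the
  two ends of the gap towards each other; in the second case each end would weigh less than
  the other.\<close>

lemma inj_on_first_gap: "inj_on first_gap {(a, b). covers a b}"
proof -
  have opposite: False
    if ab: "precedes a b" "lab a < lab b" and cd: "precedes c d" "lab d < lab c"
      and eq: "lab a = lab c - 1" for a b c d
  proof -
    have "lab c \<in> interval_between a b" "lab a \<in> interval_between c d"
      using ab(2) cd(2) eq unfolding interval_between_def atLeastAtMost_iff by linarith+
    moreover have "a \<noteq> c" using cd(2) eq by auto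
    ultimately show False
      using precedes_less[OF ab(1), of c] precedes_less[OF cd(1), of a] by (metis less_asym)
  qed
  have same: "b = b'" if "covers a b" "covers a b'" "lab a < lab b \<longleftrightarrow> lab a < lab b'" for a b b'
  proof (rule ccontr)
    assume "b \<noteq> b'"
    moreover have "lab b \<in> interval_between a b' \<or> lab b' \<in> interval_between a b"
      using that(3) unfolding interval_between_def atLeastAtMost_iff by linarith
    ultimately show False
      using covers_same_side[of a b b'] covers_same_side[of a b' b] that(1,2) by blast
  qed
  show ?thesis
  proof (rule inj_onI, clarify)
    fix a b c d
    assume cov: "covers a b" "covers c d" and eq: "first_gap (a, b) = first_gap (c, d)"
    have prec: "precedes a b" "precedes c d" using cov by (auto simp: covers_def)
    then have ne: "lab a < lab b \<or> lab b < lab a" "lab c < lab d \<or> lab d < lab c"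
      by (auto simp: precedes_def simp flip: neq_iff)
    have side: "lab a < lab b \<longleftrightarrow> lab c < lab d"
      using eq opposite[OF prec(1) _ prec(2)] opposite[OF prec(2) _ prec(1)] ne
      unfolding first_gap_def prod.case by (metis less_asym)
    then have "lab a = lab c"
      using eq ne by (auto simp: first_gap_def simp del: lab_eq_iff split: if_splits)
    then have "a = c" by simp
    then show "a = c \<and> b = d" using same[of a b d] cov side by auto
  qed
qed

definition edge_vectors :: "(real ^ 'n) set" where
  "edge_vectors = (\<lambda>(a, b). axis b 1 - axis a 1) ` {(a, b). covers a b}"

lemma card_edge_vectors: "card edge_vectors \<le> n"
proof -
  have "first_gap ` {(a, b). covers a b} \<subseteq> {..<n}"
  proof clarsimp
    fix a b assume "covers a b"
    then have "lab a < lab b \<or> lab b < lab a"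
      by (auto simp: covers_def precedes_def simp flip: neq_iff)
    then show "first_gap (a, b) < n"
      using lab_le[of a] lab_le[of b] by (auto simp: first_gap_def)
  qed
  then have "card {(a, b). covers a b} \<le> n"
    using card_inj_on_le[OF inj_on_first_gap, of "{..<n}"] by simp
  then show ?thesis
    unfolding edge_vectors_def using card_image_le[OF finite] le_trans by blast
qed

lemma precedes_in_cone:
  assumes "precedes a b"
  shows "axis b 1 - axis a 1 \<in> convex_cone hull edge_vectors"
  using assms
  \<comment> \<open>Splitting related pairs ends because the weights of the two ends draw closer: fewer
    indices have their weight strictly in between.\<close>
proof (induction "card {k. w a < w k \<and> w k < w b}" arbitrary: a b rule: less_induct)
  case less
  show ?case
  proof (cases "covers a b")
    case True
    then show ?thesis by (auto simp: edge_vectors_def intro!: hull_inc)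
  next
    case False
    then obtain c where c: "precedes a c" "precedes c b"
      using less.prems by (auto simp: covers_def)
    have "w a < w c" "w c < w b"
      using c precedes_less[OF c(1), of c] precedes_less[OF c(2), of b]
      by (auto simp: precedes_def)
    then have "axis c 1 - axis a 1 \<in> convex_cone hull edge_vectors"
      "axis b 1 - axis c 1 \<in> convex_cone hull edge_vectors"
      using c by (auto intro!: less.hyps psubset_card_mono)
    from convex_cone_hull_add[OF this] show ?thesis by simp
  qed
qed

text \<open>Together with one coordinate vector, the edge vectors span the whole space, because
  consecutive indices are always related; there are too few of them to be dependent.\<close>

lemma independent_edge_vectors: "independent edge_vectors"
proof -
  obtain z where z: "lab z = 0" using lab_surj[of 0] by auto
  let ?B = "insert (axis z 1) edge_vectors"
  have diff: "axis b 1 - axis a 1 \<in> span ?B" if "precedes a b" for a b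
    using precedes_in_cone[OF that] convex_cone_hull_subset_span span_mono[of edge_vectors ?B]
    by blast
  have "axis a 1 \<in> span ?B" if "lab a = k" for a k
    using that
  proof (induction k arbitrary: a)
    case 0
    then have "a = z" using z lab_eq_iff[of a z] by simp
    then show ?case by (auto intro: span_base)
  next
    case (Suc k)
    then have "k < n" using lab_le[of a] by simp
    then obtain b where b: "lab b = k" using lab_surj[of k] by auto
    have G: "interval_between a b \<in> \<G>"
      using consecutive[OF \<open>k < n\<close>] Suc.prems b by (simp add: interval_between_def)
    have "least (interval_between a b) = a \<or> least (interval_between a b) = b"
      using least_mem[OF G] Suc.prems b unfolding interval_between_def
      by (metis atLeastAtMost_iff lab_eq_iff le_SucE le_antisym lessI max.absorb3 min.absorb4)
    moreover have "a \<noteq> b" using Suc.prems b by auto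
    ultimately have "precedes a b \<or> precedes b a"
      using least_precedes[OF G, of a] least_precedes[OF G, of b] by auto
    then have "axis a 1 - axis b 1 \<in> span ?B"
      using diff[of a b] diff[of b a] span_neg[of "axis b 1 - axis a 1"] by auto
    from span_add[OF this Suc.IH[OF b]] show ?case by simp
  qed
  then have axis: "axis a 1 \<in> span ?B" for a by simp
  have "x \<in> span ?B" for x
  proof -
    have "(\<Sum>i\<in>UNIV. (x $ i) *\<^sub>R axis i 1) \<in> span ?B"
      using axis by (intro span_sum span_scale)
    then show ?thesis using basis_expansion[of x] by (simp add: scalar_mult_eq_scaleR)
  qed
  then have "UNIV \<subseteq> span ?B" by blast
  moreover have fin: "finite ?B" by (simp add: edge_vectors_def)
  moreover have "card ?B \<le> dim (UNIV :: (real ^ 'n) set)"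
  proof -
    have "CARD('n) = Suc n" using bij_betw_same_card[OF lab] by simp
    then show ?thesis using card_insert_le_m1 card_edge_vectors fin
      by (simp add: card_insert_if)
  qed
  ultimately have "independent ?B"
    by (intro card_le_dim_spanning[of _ UNIV]) auto
  then show ?thesis by (rule independent_mono) auto
qed

definition vertex :: "real ^ 'n" where
  "vertex = (\<Sum>G\<in>\<G>. axis (least G) 1)"

lemma vertex_mem: "vertex \<in> collection_polytope lab \<G>"
  unfolding vertex_def collection_polytope_def set_sum_alt[OF finite_collection]
  using least_mem by (intro CollectI exI[of _ "\<lambda>G. axis (least G) 1"]) (simp add: axis_in_face_simplex)

text \<open>Only the summand of the interval spanned by \<open>a\<close> and \<open>b\<close> moves, from \<open>e\<^sub>a\<close> to \<open>e\<^sub>b\<close>.\<close>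

lemma vertex_plus_edge:
  assumes "u \<in> edge_vectors"
  shows "vertex + u \<in> collection_polytope lab \<G>"
proof -
  obtain a b where u: "u = axis b 1 - axis a 1" and "precedes a b"
    using assms by (auto simp: edge_vectors_def covers_def)
  then have G: "interval_between a b \<in> \<G>" "least (interval_between a b) = a" by (auto simp: precedes_def)
  define s where "s G = (if G = interval_between a b then axis b 1 else axis (least G) (1::real))" for G
  have "vertex + u = sum s \<G>"
    using finite_collection G
    by (simp add: vertex_def u s_def sum.remove[of \<G> "interval_between a b"])
  moreover have "\<forall>G\<in>\<G>. s G \<in> face_simplex lab G"
    using least_mem by (auto simp: s_def axis_in_face_simplex)
  ultimately show ?thesis
    unfolding collection_polytope_def set_sum_alt[OF finite_collection] by blast
qed

text \<open>A point of \<open>\<Delta>\<^sub>G\<close> is a convex combination of the \<open>e\<^sub>i\<close> with \<open>i \<in> G\<close>, so it differs from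
  the least vertex \<open>e\<^sub>c\<close> of \<open>\<Delta>\<^sub>G\<close> by a nonnegative combination of the \<open>e\<^sub>i - e\<^sub>c\<close>.\<close>

lemma polytope_in_vertex_cone:
  assumes "x \<in> collection_polytope lab \<G>"
  shows "x - vertex \<in> convex_cone hull edge_vectors"
proof -
  obtain s where x: "x = sum s \<G>" and s: "\<And>G. G \<in> \<G> \<Longrightarrow> s G \<in> face_simplex lab G"
    using assms unfolding collection_polytope_def set_sum_alt[OF finite_collection] by blast
  have "s G - axis (least G) 1 \<in> convex_cone hull edge_vectors" if G: "G \<in> \<G>" for G
  proof -
    let ?c = "least G"
    have "(\<Sum>i\<in>UNIV. (s G $ i) *\<^sub>R (axis i 1 - axis ?c 1)) \<in> convex_cone hull edge_vectors"
    proof (rule convex_cone_hull_sum)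
      fix i
      show "(s G $ i) *\<^sub>R (axis i 1 - axis ?c 1) \<in> convex_cone hull edge_vectors"
      proof (cases "lab i \<in> G \<and> i \<noteq> ?c")
        case True
        then have "axis i 1 - axis ?c 1 \<in> convex_cone hull edge_vectors"
          using least_precedes[OF G] precedes_in_cone by blast
        then show ?thesis
          using s[OF G] by (intro convex_cone_hull_mul) (auto simp: face_simplex_def)
      next
        case False
        then have "(s G $ i) *\<^sub>R (axis i 1 - axis ?c 1 :: real ^ 'n) = 0"
          using s[OF G] by (auto simp: face_simplex_def)
        then show ?thesis by (metis convex_cone_hull_contains_0)
      qed
    qed
    also have "(\<Sum>i\<in>UNIV. (s G $ i) *\<^sub>R (axis i 1 - axis ?c 1))
        = (\<Sum>i\<in>UNIV. (s G $ i) *\<^sub>R axis i 1) - (\<Sum>i\<in>UNIV. s G $ i) *\<^sub>R axis ?c 1"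
      by (simp add: scaleR_diff_right sum_subtractf scaleR_sum_left)
    also have "\<dots> = s G - axis ?c 1"
      using basis_expansion[of "s G"] s[OF G]
      by (simp add: scalar_mult_eq_scaleR face_simplex_def)
    finally show ?thesis .
  qed
  then have "(\<Sum>G\<in>\<G>. s G - axis (least G) 1) \<in> convex_cone hull edge_vectors"
    by (rule convex_cone_hull_sum)
  then show ?thesis by (simp add: x vertex_def sum_subtractf)
qed

lemma facets_at_vertex:
  "int (card {F. F facet_of collection_polytope lab \<G> \<and> vertex \<in> F})
     = aff_dim (collection_polytope lab \<G>)"
proof -
  have "card {F. F facet_of collection_polytope lab \<G> \<and> vertex \<in> F} = card edge_vectors"
    and "aff_dim (collection_polytope lab \<G>) = int (card edge_vectors)"
    using facets_at_simplicial_vertex[of "collection_polytope lab \<G>" vertex edge_vectors]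
      polytope_collection_polytope[OF finite_collection] vertex_mem independent_edge_vectors
      vertex_plus_edge polytope_in_vertex_cone
    by metis+
  then show ?thesis by simp
qed

end

context interval_collection
begin

text \<open>Vertices of a polytope are exposed. The exposing functional, with its sign reversed to turn
  maxima into minima, is a generic weight: a second minimiser of one summand would yield a
  second minimiser of the sum.\<close>

lemma extreme_point_generic_weight:
  assumes "v extreme_point_of collection_polytope lab \<G>"
  obtains w where "generic_weight n lab \<G> w" "v = generic_weight.vertex lab \<G> w"
proof -
  let ?P = "collection_polytope lab \<G>"
  have "{v} exposed_face_of ?P"
    using assms polytope_imp_polyhedron[OF polytope_collection_polytope[OF finite_collection, of lab]]
    by (simp add: exposed_face_of_polyhedron face_of_singleton)
  then obtain a b where upper: "?P \<subseteq> {x. a \<bullet> x \<le> b}" and v_eq: "{v} = ?P \<inter> {x. a \<bullet> x = b}"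
    unfolding exposed_face_of_def by blast
  have vP: "v \<in> ?P" and av: "a \<bullet> v = b" using v_eq by blast+
  have unique: "x = v" if "x \<in> ?P" "a \<bullet> v \<le> a \<bullet> x" for x
  proof -
    have "a \<bullet> x = b" using upper that av by (intro antisym) auto
    then show ?thesis using v_eq that(1) by blast
  qed
  obtain s where v: "v = sum s \<G>" and s: "\<And>G. G \<in> \<G> \<Longrightarrow> s G \<in> face_simplex lab G"
    using vP unfolding collection_polytope_def set_sum_alt[OF finite_collection] by blast
  have unique_summand: "y = s G"
    if G: "G \<in> \<G>" and y: "y \<in> face_simplex lab G" "a \<bullet> s G \<le> a \<bullet> y" for G y
  proof -
    have eq: "sum (s(G := y)) \<G> = v + (y - s G)"
      using finite_collection G
      by (simp add: v sum.remove[of \<G> G] cong: sum.cong_simp)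
    have "sum (s(G := y)) \<G> \<in> ?P"
      unfolding collection_polytope_def set_sum_alt[OF finite_collection]
      using s y by (intro CollectI exI[of _ "s(G := y)"]) auto
    then show ?thesis
      using unique[of "v + (y - s G)"] y(2) unfolding eq by (simp add: inner_add_right inner_diff_right)
  qed
  define w where "w i = - (a $ i)" for i
  have min: "\<exists>c. lab c \<in> G \<and> s G = axis c 1 \<and> (\<forall>k. lab k \<in> G \<longrightarrow> k \<noteq> c \<longrightarrow> w c < w k)"
    if G: "G \<in> \<G>" for G
  proof -
    let ?I = "{i. lab i \<in> G}"
    have supp: "\<And>i. i \<notin> ?I \<Longrightarrow> s G $ i = 0" and nonneg: "\<And>i. s G $ i \<ge> 0"
      and total: "(\<Sum>i\<in>UNIV. s G $ i) = 1"
      using s[OF G] by (auto simp: face_simplex_def)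
    \<comment> \<open>The functional is at most its value at the best vertex \<open>e\<^sub>c\<close> of the summand, so by
      uniqueness the summand of \<open>v\<close> is \<open>e\<^sub>c\<close>, and no other vertex is as good.\<close>
    have "?I \<noteq> {}"
    proof
      assume "?I = {}"
      then have "s G $ i = 0" for i using supp by blast
      then show False using total by simp
    qed
    then have "Max (($) a ` ?I) \<in> ($) a ` ?I" by (intro Max_in) auto
    then obtain c where "c \<in> ?I" and Max: "Max (($) a ` ?I) = a $ c" by blast
    have c: "lab c \<in> G" "\<And>i. lab i \<in> G \<Longrightarrow> a $ i \<le> a $ c"
      using \<open>c \<in> ?I\<close> by (auto simp flip: Max)
    have "a \<bullet> s G = (\<Sum>i\<in>UNIV. a $ i * s G $ i)" by (simp add: inner_vec_def)
    also have "\<dots> \<le> (\<Sum>i\<in>UNIV. a $ c * s G $ i)"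
    proof (rule sum_mono)
      show "a $ i * s G $ i \<le> a $ c * s G $ i" for i
        using c(2)[of i] supp[of i] nonneg[of i] by (cases "lab i \<in> G") (auto intro: mult_right_mono)
    qed
    also have "\<dots> = a $ c" using total by (simp flip: sum_distrib_left)
    finally have le: "a \<bullet> s G \<le> a $ c" .
    have eq: "axis k 1 = s G" if "lab k \<in> G" "a $ c \<le> a $ k" for k
      using that le by (intro unique_summand[OF G]) (auto simp: axis_in_face_simplex inner_axis)
    have "a $ k < a $ c" if "lab k \<in> G" "k \<noteq> c" for k
    proof (rule ccontr)
      assume "\<not> a $ k < a $ c"
      then have "axis k 1 = (axis c 1 :: real ^ 'n)" using eq[of k] eq[of c] that c(1) by simp
      then show False using that(2) by (simp add: axis_eq_axis)
    qed
    then show ?thesis using eq[of c] c by (auto simp: w_def)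
  qed
  have gen: "generic_weight n lab \<G> w"
    using min by unfold_locales blast
  then interpret generic_weight n lab \<G> w .
  have "s G = axis (least G) 1" if "G \<in> \<G>" for G
    using min[OF that] least_mem[OF that] least_less[OF that] by (metis less_asym)
  then have "v = vertex" by (simp add: v vertex_def)
  with gen that show ?thesis by blast
qed

theorem simple_collection_polytope: "simple_polytope (collection_polytope lab \<G>)"
  unfolding simple_polytope_def
  using polytope_collection_polytope[OF finite_collection] extreme_point_generic_weight
    generic_weight.facets_at_vertex by metis

end

section \<open>Intervals below a Dyck path\<close>

text \<open>The crossing height is bounded below in two ways: by the height of the start of the path,
  which makes the collection closed under subintervals, and, for a Dyck path, by the condition on
  the vertex reached in the next column, which puts all consecutive pairs into the collection.\<close>

lemma path_crosses_column:
  assumes "successively lattice_step xs" "xs \<noteq> []" "fst (hd xs) \<le> a" "a < fst (last xs)"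
  shows "\<exists>h\<ge>snd (hd xs). (a, h) \<in> set xs \<and> (Suc a, h) \<in> set xs"
  using assms
proof (induction xs)
  case (Cons p xs)
  then have "xs \<noteq> []" by auto
  then have step: "lattice_step p (hd xs)" and path: "successively lattice_step xs"
    using Cons.prems by (auto simp: successively_Cons)
  show ?case
  proof (cases "fst (hd xs) \<le> a")
    case True
    then obtain h where "h \<ge> snd (hd xs)" "(a, h) \<in> set xs" "(Suc a, h) \<in> set xs"
      using Cons.IH path \<open>xs \<noteq> []\<close> Cons.prems by auto
    moreover have "snd p \<le> snd (hd xs)" using step by (auto simp: lattice_step_def)
    ultimately show ?thesis by (auto intro!: exI[of _ h])
  next
    case False
    then have "p = (a, snd p)" "hd xs = (Suc a, snd p)"
      using step Cons.prems by (auto simp: lattice_step_def)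
    moreover have "hd xs \<in> set xs" using \<open>xs \<noteq> []\<close> by simp
    ultimately show ?thesis
      by (intro exI[of _ "snd p"]) (metis list.sel(1) list.set_intros(1,2) order_refl)
  qed
qed simp

lemma dyck_collection_iff:
  "G \<in> dyck_collection n D \<longleftrightarrow>
     (\<exists>i j. G = {i..j} \<and> i < j \<and> j \<le> n \<and> on_or_below (Suc i, j) D)"
proof
  assume "G \<in> dyck_collection n D"
  then obtain a b where "1 \<le> a" "G = {a - 1..b}" "b \<le> n" "on_or_below (a, b) D"
    "card {a - 1..b} > 1"
    by (auto simp: dyck_collection_def interval_label_def)
  then show "\<exists>i j. G = {i..j} \<and> i < j \<and> j \<le> n \<and> on_or_below (Suc i, j) D"
    by (intro exI[of _ "a - 1"] exI[of _ b]) auto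
next
  assume "\<exists>i j. G = {i..j} \<and> i < j \<and> j \<le> n \<and> on_or_below (Suc i, j) D"
  then obtain i j where "G = {i..j}" "i < j" "j \<le> n" "on_or_below (Suc i, j) D" by blast
  then show "G \<in> dyck_collection n D"
    unfolding dyck_collection_def interval_label_def
    by (intro CollectI exI[of _ "Suc i"] exI[of _ j]) auto
qed

lemma dyck_interval_collection:
  assumes lab: "bij_betw lab UNIV {0..n}" and D: "dyck_path n D"
  shows "interval_collection n lab (dyck_collection n D)"
proof
  have path: "successively lattice_step D" "D \<noteq> []" "hd D = (1, 0)" "last D = (n + 1, n)"
    and above: "\<And>i j. (i, j) \<in> set D \<Longrightarrow> i \<le> j + 1"
    using D by (auto simp: dyck_path_def)
  show "bij_betw lab UNIV {0..n}" by fact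
  show "\<exists>i j. i < j \<and> j \<le> n \<and> G = {i..j}" if "G \<in> dyck_collection n D" for G
    using that by (auto simp: dyck_collection_iff)
  show "{k..Suc k} \<in> dyck_collection n D" if k: "k < n" for k
  proof -
    obtain h where "(Suc k, h) \<in> set D" "(Suc (Suc k), h) \<in> set D"
      using path_crosses_column[OF path(1,2), of "Suc k"] path k by auto
    then show ?thesis
      using above[of "Suc (Suc k)" h] k
      by (auto simp: dyck_collection_iff on_or_below_def intro!: exI[of _ k] exI[of _ "Suc k"] exI[of _ h])
  qed
  show "{i'..j'} \<in> dyck_collection n D"
    if ij: "{i..j} \<in> dyck_collection n D" and sub: "i \<le> i'" "i' < j'" "j' \<le> j" for i j i' j'
  proof -
    obtain h where h: "(Suc i, h) \<in> set D" "j \<le> h" and "j \<le> n"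
      using ij sub by (auto simp: dyck_collection_iff on_or_below_def Icc_eq_Icc)
    obtain ys zs where split: "D = ys @ (Suc i, h) # zs" using h(1) by (meson split_list)
    have "successively lattice_step ((Suc i, h) # zs)"
      using path(1) unfolding split by (simp add: successively_append_iff)
    moreover have "last ((Suc i, h) # zs) = (n + 1, n)" using path(4) unfolding split by simp
    ultimately obtain h' where "h' \<ge> h" "(Suc i', h') \<in> set ((Suc i, h) # zs)"
      using path_crosses_column[of "(Suc i, h) # zs" "Suc i'"] sub \<open>j \<le> n\<close> by auto
    then have "h' \<ge> j'" "(Suc i', h') \<in> set D"
      using h sub unfolding split by auto
    then have "on_or_below (Suc i', j') D" by (auto simp: on_or_below_def)
    then show ?thesis using sub \<open>j \<le> n\<close> by (auto simp: dyck_collection_iff)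
  qed
qed

theorem proposition5p4:
  fixes n :: nat
    and D :: "(nat \<times> nat) list"
    and lab :: "'n::finite \<Rightarrow> nat"
  assumes "bij_betw lab UNIV {0..n}"
    and "dyck_path n D"
  shows "simple_polytope (collection_polytope lab (dyck_collection n D))"
  using dyck_interval_collection[OF assms] by (rule interval_collection.simple_collection_polytope)

end
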